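(* Let $\mathbf{m}=\{m_n\}_{n\ge 1}$ be a sequence of integers with $m_n\ge 2$ for every $n\ge 1$, let $T_{\mathbf{m}}$ be the corresponding spherically homogeneous rooted tree, and let $G\le \mathrm{Aut}\,T_{\mathbf{m}}$. Suppose that there exists a prime $p\ge 2$ such that for every vertex $v\in T_{\mathbf{m}}$, the subgroup $\mathrm{rist}_G(v)$ has an element of (finite) order divisible by $p$. Then $G$ contains a continuum (a family of cardinality $2^{\aleph_0}$) of pairwise distinct ERF subgroups which are not closed in the congruence topology on $G$.
   Context: For a sequence $\mathbf{m}=\{m_n\}_{n\ge 1}$ of integers $m_n\ge 2$, $T_{\mathbf{m}}$ is the rooted tree in which every vertex at level $n-1$ has exactly $m_n$ immediate descendants, for each $n\ge 1$ (the root is at level $0$). $\mathrm{Aut}\,T_{\mathbf{m}}$ is the group of its (root-preserving) automorphisms. For a vertex $v$, $T_{\mathbf{m}}^v$ is the subtree rooted at $v$. For $G\le \mathrm{Aut}\,T_{\mathbf{m}}$, the rigid stabilizer $\mathrm{rist}_G(v)$ is the subgroup of elements of $G$ acting trivially on $T_{\mathbf{m}}\setminus T_{\mathbf{m}}^v$, and $\mathrm{st}_G(n)$ is the pointwise stabilizer in $G$ of the $n$-th level of $T_{\mathbf{m}}$. The congruence topology on $G$ is the group topology in which the level stabilizers $\{\mathrm{st}_G(n)\}_{n\ge 1}$ form a basis of open neighbourhoods of the identity. The profinite topology on a group is the group topology in which the finite-index subgroups form a basis of open neighbourhoods of the identity. A group is ERF (extended residually finite) if all of its subgroups are closed in its own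 profinite topology. *)

theory Defs
  imports
    "HOL-Analysis.Analysis"
    "HOL-Algebra.Bij"
    "HOL-Algebra.Multiplicative_Group"
    "HOL-Library.Sublist"
    "HOL-Library.Equipollence"
begin

section \<open>Spherically homogeneous rooted trees and their automorphisms\<close>

text \<open>
  A vertex is the list of child numbers on the path leading to it from the root \<open>[]\<close>; a vertex
  at level \<open>k\<close> has the children \<open>v @ [a]\<close> with \<open>a < m (k + 1)\<close>. The value \<open>m 0\<close> is not used.
\<close>

definition tree_verts :: "(nat \<Rightarrow> nat) \<Rightarrow> nat list set" where
  "tree_verts m = {v. \<forall>i < length v. v ! i < m (Suc i)}"

definition tree_adj :: "(nat \<Rightarrow> nat) \<Rightarrow> nat list \<Rightarrow> nat list \<Rightarrow> bool" where
  "tree_adj m u v \<longleftrightarrow>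
     u \<in> tree_verts m \<and> v \<in> tree_verts m \<and> (\<exists>a. v = u @ [a] \<or> u = v @ [a])"

definition tree_auts :: "(nat \<Rightarrow> nat) \<Rightarrow> (nat list \<Rightarrow> nat list) set" where
  "tree_auts m =
     {f \<in> Bij (tree_verts m).
        f [] = [] \<and>
        (\<forall>u \<in> tree_verts m. \<forall>v \<in> tree_verts m. tree_adj m (f u) (f v) \<longleftrightarrow> tree_adj m u v)}"

definition Aut_tree :: "(nat \<Rightarrow> nat) \<Rightarrow> (nat list \<Rightarrow> nat list) monoid" where
  "Aut_tree m = BijGroup (tree_verts m) \<lparr>carrier := tree_auts m\<rparr>"

definition subtree_verts :: "(nat \<Rightarrow> nat) \<Rightarrow> nat list \<Rightarrow> nat list set" where
  "subtree_verts m v = {w \<in> tree_verts m. prefix v w}"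

definition rist ::
  "(nat \<Rightarrow> nat) \<Rightarrow> (nat list \<Rightarrow> nat list) set \<Rightarrow> nat list \<Rightarrow> (nat list \<Rightarrow> nat list) set" where
  "rist m G v = {g \<in> G. \<forall>w \<in> tree_verts m - subtree_verts m v. g w = w}"

definition level_stab ::
  "(nat \<Rightarrow> nat) \<Rightarrow> (nat list \<Rightarrow> nat list) set \<Rightarrow> nat \<Rightarrow> (nat list \<Rightarrow> nat list) set" where
  "level_stab m G n = {g \<in> G. \<forall>w \<in> tree_verts m. length w = n \<longrightarrow> g w = w}"


section \<open>Topologies on a group given by families of subgroups\<close>

text \<open>
  When \<open>N\<close> is a nonempty family of subgroups, directed downwards and cofinally stable under
  conjugation, this is the group topology with \<open>N\<close> as a basis of open neighbourhoods of the
  identity.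
\<close>

definition subgroup_topology :: "('a, 'b) monoid_scheme \<Rightarrow> 'a set set \<Rightarrow> 'a topology" where
  "subgroup_topology H N =
     topology (\<lambda>U. U \<subseteq> carrier H \<and> (\<forall>g \<in> U. \<exists>K \<in> N. g <#\<^bsub>H\<^esub> K \<subseteq> U))"

definition profinite_topology :: "('a, 'b) monoid_scheme \<Rightarrow> 'a topology" where
  "profinite_topology H = subgroup_topology H {K. subgroup K H \<and> finite (rcosets\<^bsub>H\<^esub> K)}"

definition congruence_topology ::
  "(nat \<Rightarrow> nat) \<Rightarrow> (nat list \<Rightarrow> nat list) set \<Rightarrow> (nat list \<Rightarrow> nat list) topology" where
  "congruence_topology m G =
     subgroup_topology (Aut_tree m \<lparr>carrier := G\<rparr>) {level_stab m G n | n. n \<ge> 1}"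

definition ERF :: "('a, 'b) monoid_scheme \<Rightarrow> bool" where
  "ERF H \<longleftrightarrow> group H \<and> (\<forall>K. subgroup K H \<longrightarrow> closedin (profinite_topology H) K)"


section \<open>Basic facts\<close>

text \<open>The predicates passed to \<^const>\<open>topology\<close> do satisfy \<^const>\<open>istopology\<close>, so the topologies above have the intended open sets.\<close>

lemma openin_subgroup_topology:
  assumes ne: "N \<noteq> {}"
    and dir: "\<And>K L. K \<in> N \<Longrightarrow> L \<in> N \<Longrightarrow> \<exists>M \<in> N. M \<subseteq> K \<inter> L"
  shows "openin (subgroup_topology H N) U \<longleftrightarrow>
           U \<subseteq> carrier H \<and> (\<forall>g \<in> U. \<exists>K \<in> N. g <#\<^bsub>H\<^esub> K \<subseteq> U)"
proof -
  let ?P = "\<lambda>U. U \<subseteq> carrier H \<and> (\<forall>g \<in> U. \<exists>K \<in> N. g <#\<^bsub>H\<^esub> K \<subseteq> U)"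
  have inter: "?P (S \<inter> T)" if "?P S" "?P T" for S T
  proof -
    have "\<exists>M \<in> N. g <#\<^bsub>H\<^esub> M \<subseteq> S \<inter> T" if "g \<in> S \<inter> T" for g
    proof -
      obtain K L where "K \<in> N" "g <#\<^bsub>H\<^esub> K \<subseteq> S" "L \<in> N" "g <#\<^bsub>H\<^esub> L \<subseteq> T"
        using \<open>?P S\<close> \<open>?P T\<close> \<open>g \<in> S \<inter> T\<close> by blast
      moreover obtain M where "M \<in> N" "M \<subseteq> K \<inter> L"
        using dir calculation by blast
      ultimately show ?thesis
        unfolding l_coset_def by (intro bexI[of _ M]) blast+
    qed
    then show ?thesis using \<open>?P S\<close> by blast
  qed
  have "istopology ?P"
    unfolding istopology_def
  proof (intro conjI allI impI)
    fix S T assume "?P S" "?P T" then show "S \<inter> T \<subseteq> carrier H"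
      and "\<forall>g \<in> S \<inter> T. \<exists>K \<in> N. g <#\<^bsub>H\<^esub> K \<subseteq> S \<inter> T"
      using inter[of S T] by simp_all
  next
    fix \<K> assume "\<forall>K \<in> \<K>. ?P K"
    then show "\<Union>\<K> \<subseteq> carrier H" and "\<forall>g \<in> \<Union>\<K>. \<exists>K \<in> N. g <#\<^bsub>H\<^esub> K \<subseteq> \<Union>\<K>"
      by (auto, meson Sup_upper2)
  qed
  then show ?thesis
    by (simp add: subgroup_topology_def topology_inverse')
qed

lemma (in group) finite_rcosets_Int:
  assumes K: "subgroup K G" "finite (rcosets K)" and L: "subgroup L G" "finite (rcosets L)"
  shows "finite (rcosets (K \<inter> L))"
proof -
  have eq: "(K \<inter> L) #> x = (K #> x) \<inter> (L #> x)" if x: "x \<in> carrier G" for x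
  proof
    show "(K \<inter> L) #> x \<subseteq> (K #> x) \<inter> (L #> x)"
      by (auto simp: r_coset_def)
    show "(K #> x) \<inter> (L #> x) \<subseteq> (K \<inter> L) #> x"
    proof
      fix y assume "y \<in> (K #> x) \<inter> (L #> x)"
      then obtain k l where "k \<in> K" "l \<in> L" "y = k \<otimes> x" "y = l \<otimes> x"
        by (auto simp: r_coset_def)
      moreover from this have "k = l"
        using x subgroup.mem_carrier[OF K(1)] subgroup.mem_carrier[OF L(1)] by (metis right_cancel)
      ultimately show "y \<in> (K \<inter> L) #> x"
        by (auto simp: r_coset_def)
    qed
  qed
  have "rcosets (K \<inter> L) \<subseteq> (\<lambda>(A, B). A \<inter> B) ` ((rcosets K) \<times> (rcosets L))"
    using eq by (force simp: RCOSETS_def)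
  then show ?thesis
    using K(2) L(2) by (meson finite_SigmaI finite_imageI finite_subset)
qed

lemma (in group) openin_profinite_topology:
  "openin (profinite_topology G) U \<longleftrightarrow>
     U \<subseteq> carrier G \<and> (\<forall>g \<in> U. \<exists>K. subgroup K G \<and> finite (rcosets K) \<and> g <# K \<subseteq> U)"
proof -
  let ?N = "{K. subgroup K G \<and> finite (rcosets K)}"
  have "rcosets (carrier G) = {carrier G}"
    by (auto simp: RCOSETS_def coset_join2 subgroup_self intro!: bexI[of _ \<one>])
  then have "carrier G \<in> ?N"
    by (simp add: subgroup_self)
  moreover have "\<exists>M \<in> ?N. M \<subseteq> K \<inter> L" if "K \<in> ?N" "L \<in> ?N" for K L
    using that finite_rcosets_Int subgroups_Inter_pair by (intro bexI[of _ "K \<inter> L"]) auto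
  ultimately show ?thesis
    unfolding profinite_topology_def by (subst openin_subgroup_topology) blast+
qed

lemma tree_auts_preserve:
  assumes "f \<in> tree_auts m" "v \<in> tree_verts m"
  shows "f v \<in> tree_verts m"
  using assms by (auto simp: tree_auts_def dest: Bij_imp_funcset)

lemma group_Aut_tree: "group (Aut_tree m)"
proof -
  interpret B: group "BijGroup (tree_verts m)"
    by (rule group_BijGroup)
  have root: "[] \<in> tree_verts m"
    by (simp add: tree_verts_def)
  have bij: "f \<in> Bij (tree_verts m)" if "f \<in> tree_auts m" for f
    using that by (simp add: tree_auts_def)
  have "subgroup (tree_auts m) (BijGroup (tree_verts m))"
  proof (rule B.subgroupI)
    show "tree_auts m \<subseteq> carrier (BijGroup (tree_verts m))"
      by (auto simp: BijGroup_def bij)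
    show "tree_auts m \<noteq> {}"
      using root by (auto simp: tree_auts_def id_Bij intro!: exI[of _ "\<lambda>x \<in> tree_verts m. x"])
  next
    fix f assume f: "f \<in> tree_auts m"
    let ?i = "\<lambda>x \<in> tree_verts m. inv_into (tree_verts m) f x"
    have b: "bij_betw f (tree_verts m) (tree_verts m)"
      using bij[OF f] by (simp add: Bij_def)
    have mem: "inv_into (tree_verts m) f x \<in> tree_verts m"
      and can: "f (inv_into (tree_verts m) f x) = x" if "x \<in> tree_verts m" for x
      using b that by (auto simp: bij_betw_def f_inv_into_f inv_into_into)
    have "f [] = []"
      using f by (simp add: tree_auts_def)
    then have "inv_into (tree_verts m) f [] = []"
      using b root by (metis bij_betw_def inv_into_f_f)
    moreover have "tree_adj m (?i u) (?i v) \<longleftrightarrow> tree_adj m u v"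
      if "u \<in> tree_verts m" "v \<in> tree_verts m" for u v
    proof -
      have "tree_adj m (f (?i u)) (f (?i v)) \<longleftrightarrow> tree_adj m (?i u) (?i v)"
        using f mem that by (simp add: tree_auts_def)
      then show ?thesis
        using that can by simp
    qed
    ultimately have "?i \<in> tree_auts m"
      using root restrict_inv_into_Bij[OF bij[OF f]] by (simp add: tree_auts_def)
    then show "inv\<^bsub>BijGroup (tree_verts m)\<^esub> f \<in> tree_auts m"
      by (simp add: inv_BijGroup[OF bij[OF f]])
  next
    fix f g assume f: "f \<in> tree_auts m" and g: "g \<in> tree_auts m"
    have "compose (tree_verts m) f g \<in> tree_auts m"
      using f g root tree_auts_preserve[OF g] compose_Bij[OF bij[OF f] bij[OF g]]
      by (simp add: tree_auts_def compose_def)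
    then show "f \<otimes>\<^bsub>BijGroup (tree_verts m)\<^esub> g \<in> tree_auts m"
      using bij[OF f] bij[OF g] by (simp add: BijGroup_def)
  qed
  then show ?thesis
    unfolding Aut_tree_def by (rule B.subgroup_imp_group)
qed

lemma tree_auts_length:
  assumes f: "f \<in> tree_auts m" and "v \<in> tree_verts m"
  shows "length (f v) = length v"
  using assms(2)
proof (induction v rule: length_induct)
  case (1 v)
  have b: "bij_betw f (tree_verts m) (tree_verts m)"
    using f by (simp add: tree_auts_def Bij_def)
  have inj: "inj_on f (tree_verts m)"
    using b by (simp add: bij_betw_def)
  have pre: "butlast w \<in> tree_verts m" if "w \<in> tree_verts m" for w
    using that by (auto simp: tree_verts_def nth_butlast)
  show ?case
  proof (cases v rule: rev_cases)
    case Nil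
    then show ?thesis using f by (simp add: tree_auts_def)
  next
    case (snoc u a)
    have u: "u \<in> tree_verts m" "length (f u) = length u"
      using 1 snoc pre[of v] by auto
    have "tree_adj m (f u) (f v)"
      using f u 1(2) snoc by (auto simp: tree_auts_def tree_adj_def)
    then consider b where "f v = f u @ [b]" | b where "f u = f v @ [b]"
      by (auto simp: tree_adj_def)
    then show ?thesis
    proof cases
      case 1
      then show ?thesis using u snoc by simp
    next
      case (2 b)
      then have "u \<noteq> []"
        using u by auto
      let ?p = "butlast u"
      have p: "?p \<in> tree_verts m" "length (f ?p) = length ?p"
        using u pre[of u] 1 snoc \<open>u \<noteq> []\<close> by auto
      have "tree_adj m ?p u"
        using p u \<open>u \<noteq> []\<close> by (auto simp: tree_adj_def) (metis append_butlast_last_id)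
      then have "tree_adj m (f ?p) (f u)"
        using f p u by (simp add: tree_auts_def)
      then have "f ?p = f v"
        using p u 2 \<open>u \<noteq> []\<close> by (auto simp: tree_adj_def)
      then have "?p = v"
        using inj p 1(2) by (meson inj_onD)
      then show ?thesis
        using snoc by (metis butlast_snoc length_append_singleton length_butlast
            less_SucI diff_le_self not_less lessI le_less_trans)
    qed
  qed
qed

lemma level_stab_mono:
  assumes G: "G \<subseteq> tree_auts m" and m: "\<And>n. n \<ge> 1 \<Longrightarrow> m n \<ge> 2" and "k \<le> n"
  shows "level_stab m G n \<subseteq> level_stab m G k"
  using \<open>k \<le> n\<close>
proof (induction n rule: dec_induct)
  case base
  then show ?case by simp
next
  case (step n)
  have "level_stab m G (Suc n) \<subseteq> level_stab m G n"
  proof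
    fix g assume g: "g \<in> level_stab m G (Suc n)"
    then have auts: "g \<in> tree_auts m"
      using G by (auto simp: level_stab_def)
    have "g w = w" if w: "w \<in> tree_verts m" "length w = n" for w
    proof -
      have w0: "w @ [0] \<in> tree_verts m"
        using w m[of "Suc n"] by (auto simp: tree_verts_def nth_append less_Suc_eq)
      then have fix0: "g (w @ [0]) = w @ [0]"
        using g w by (simp add: level_stab_def)
      have "tree_adj m w (w @ [0])"
        using w w0 by (simp add: tree_adj_def)
      then have "tree_adj m (g w) (g (w @ [0]))"
        using auts w(1) w0 by (simp add: tree_auts_def)
      moreover have "length (g w) = length w"
        using auts w(1) by (rule tree_auts_length)
      ultimately show "g w = w"
        using fix0 by (auto simp: tree_adj_def)
    qed
    then show "g \<in> level_stab m G n"
      using g by (simp add: level_stab_def)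
  qed
  then show ?case using step.IH by blast
qed

lemma openin_congruence_topology:
  assumes G: "G \<subseteq> tree_auts m" and m: "\<And>n. n \<ge> 1 \<Longrightarrow> m n \<ge> 2"
  shows "openin (congruence_topology m G) U \<longleftrightarrow>
           U \<subseteq> G \<and> (\<forall>g \<in> U. \<exists>n \<ge> 1. g <#\<^bsub>Aut_tree m\<^esub> level_stab m G n \<subseteq> U)"
proof -
  let ?N = "{level_stab m G n | n. n \<ge> 1}"
  have "\<exists>M \<in> ?N. M \<subseteq> K \<inter> L" if KL: "K \<in> ?N" "L \<in> ?N" for K L
  proof -
    obtain i j where ij: "K = level_stab m G i" "L = level_stab m G j" "i \<ge> 1" "j \<ge> 1"
      using KL by blast
    have "level_stab m G (max i j) \<subseteq> K \<inter> L"
      using level_stab_mono[OF G m] ij by (metis Int_greatest max.cobounded1 max.cobounded2)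
    then show ?thesis
      using ij by (intro bexI[of _ "level_stab m G (max i j)"]) auto
  qed
  moreover have "?N \<noteq> {}"
    by blast
  ultimately have "openin (congruence_topology m G) U \<longleftrightarrow>
      U \<subseteq> G \<and> (\<forall>g \<in> U. \<exists>K \<in> ?N. g <#\<^bsub>Aut_tree m\<^esub> K \<subseteq> U)"
    unfolding congruence_topology_def
    by (subst openin_subgroup_topology) (simp_all add: l_coset_def)
  then show ?thesis by blast
qed

end

theory Submission
  imports Defs "HOL-Number_Theory.Cong" "HOL-Library.Groups_Big_Fun"
begin

text \<open>
  The vertices \<open>spine n\<close>, namely \<open>0, \<dots>, 0, 1\<close> with \<open>n\<close> zeros, are pairwise incomparable, so
  elements \<open>a n\<close> of order \<open>p\<close> taken from their rigid stabilizers commute and are independent: they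
  generate a vector space of countable dimension over the field with \<open>p\<close> elements, with basis the
  \<open>a n\<close>. In an abelian group of exponent \<open>p\<close> every subgroup is an intersection of hyperplanes, which
  have index \<open>p\<close>, so every such group is ERF (\<open>ERF_prime_exponent\<close>). It remains to
  find many subspaces that are not closed in the congruence topology.

  Since \<open>a n\<close> fixes level \<open>n\<close> pointwise, \<open>a n\<close> tends to the identity. For an infinite set \<open>T\<close> of
  indices containing \<open>0\<close>, consider the vectors supported on \<open>T\<close> whose coordinates add up to zero.
  They include \<open>a 0 \<otimes> inv (a n)\<close> for \<open>n\<close> in \<open>T\<close>, and these elements converge to \<open>a 0\<close>, whose
  coordinate sum is \<open>1\<close>; so this subspace is not closed (\<open>not_closedin_sum_zero_subgroup\<close>). The same
  elements show that \<open>T\<close> can be recovered from the subspace (\<open>a0_pow_a_in_iff\<close>), and there are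
  continuum many such \<open>T\<close>.
\<close>

section \<open>Abelian groups of prime exponent\<close>

lemma (in group) nat_pow_mod_exponent:
  assumes "x \<in> carrier G" and "x [^] (p :: nat) = \<one>"
  shows "x [^] (n mod p) = x [^] n"
proof -
  have "x [^] n = x [^] (p * (n div p)) \<otimes> x [^] (n mod p)"
    using assms(1) by (simp add: nat_pow_mult)
  also have "x [^] (p * (n div p)) = \<one>"
    using nat_pow_pow[OF assms(1), of p "n div p"] assms(2) by simp
  finally show ?thesis
    using assms(1) by simp
qed

lemma (in group) subgroup_Union_chain:
  assumes ne: "C \<noteq> {}" and sub: "\<And>L. L \<in> C \<Longrightarrow> subgroup L G"
    and chain: "\<And>K L. K \<in> C \<Longrightarrow> L \<in> C \<Longrightarrow> K \<subseteq> L \<or> L \<subseteq> K"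
  shows "subgroup (\<Union>C) G"
proof (rule subgroupI)
  show "\<Union>C \<subseteq> carrier G"
    using subgroup.subset[OF sub] by (rule Union_least)
  show "\<Union>C \<noteq> {}"
    using ne subgroup.one_closed[OF sub] by blast
  show "inv a \<in> \<Union>C" if "a \<in> \<Union>C" for a
    using that subgroup.m_inv_closed[OF sub] by blast
  show "a \<otimes> b \<in> \<Union>C" if ab: "a \<in> \<Union>C" "b \<in> \<Union>C" for a b
  proof -
    obtain L where "L \<in> C" "a \<in> L" "b \<in> L"
      using ab chain by blast
    then show ?thesis
      using subgroup.m_closed[OF sub] by blast
  qed
qed

text \<open>
  The powers of \<open>h\<close> with natural exponents already include the inverse of \<open>h\<close>, because \<open>h\<close> has
  finite order; so this is the subgroup generated by \<open>L\<close> and \<open>h\<close>.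
\<close>

lemma (in comm_group) subgroup_adjoin:
  assumes L: "subgroup L G" and h: "h \<in> carrier G" and p: "h [^] (p :: nat) = \<one>" "p > 0"
  shows "subgroup (\<Union>j :: nat. L #> h [^] j) G"
proof (rule subgroupI)
  note sub = subgroup.mem_carrier[OF L]
  show "(\<Union>j :: nat. L #> h [^] j) \<subseteq> carrier G"
    using sub h by (auto simp: r_coset_def)
  show "(\<Union>j :: nat. L #> h [^] j) \<noteq> {}"
    using subgroup.one_closed[OF L] by (auto simp: r_coset_def)
  show "inv a \<in> (\<Union>j :: nat. L #> h [^] j)" if "a \<in> (\<Union>j :: nat. L #> h [^] j)" for a
  proof -
    from that obtain l and j :: nat where a: "l \<in> L" "a = l \<otimes> h [^] j"
      by (auto simp: r_coset_def)
    have "j + (p - 1) * j = p * j"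
      using p(2) by (cases p) simp_all
    then have "h [^] j \<otimes> h [^] ((p - 1) * j) = h [^] (p * j)"
      using h by (simp only: nat_pow_mult)
    also have "\<dots> = \<one>"
      using nat_pow_pow[OF h, of p j] p(1) by simp
    finally have "inv (h [^] j) = h [^] ((p - 1) * j)"
      using h by (simp add: inv_equality m_comm)
    then have "inv a = inv l \<otimes> h [^] ((p - 1) * j)"
      using a h sub by (simp add: inv_mult)
    then show ?thesis
      using subgroup.m_inv_closed[OF L a(1)] by (auto simp: r_coset_def)
  qed
  show "a \<otimes> b \<in> (\<Union>j :: nat. L #> h [^] j)"
    if "a \<in> (\<Union>j :: nat. L #> h [^] j)" "b \<in> (\<Union>j :: nat. L #> h [^] j)" for a b
  proof -
    from that obtain l k and i j :: nat
      where ab: "l \<in> L" "a = l \<otimes> h [^] i" "k \<in> L" "b = k \<otimes> h [^] j"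
      by (auto simp: r_coset_def)
    have "a \<otimes> b = (l \<otimes> k) \<otimes> h [^] (i + j)"
      using ab h sub by (simp add: m_ac nat_pow_mult[symmetric])
    then show ?thesis
      using subgroup.m_closed[OF L ab(1,3)] by (auto simp: r_coset_def)
  qed
qed

text \<open>
  In the language of vector spaces over the field with \<open>p\<close> elements: a subspace maximal among those
  that contain \<open>K\<close> but not \<open>g\<close> is a hyperplane complementary to the line of \<open>g\<close>, since any \<open>h\<close>
  outside it spans together with it a space containing \<open>g\<close>, and the coefficient of \<open>h\<close> is invertible.
\<close>

lemma (in comm_group) finite_index_subgroup_avoiding:
  assumes p: "prime p" and exponent: "\<And>x. x \<in> carrier G \<Longrightarrow> x [^] (p :: nat) = \<one>"
    and K: "subgroup K G" and g: "g \<in> carrier G" "g \<notin> K"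
  obtains L where "subgroup L G" "K \<subseteq> L" "g \<notin> L" "finite (rcosets L)"
proof -
  let ?A = "{L. subgroup L G \<and> K \<subseteq> L \<and> g \<notin> L}"
  have "\<exists>L \<in> ?A. \<forall>X \<in> ?A. L \<subseteq> X \<longrightarrow> X = L"
  proof (rule subset_Zorn_nonempty)
    show "?A \<noteq> {}"
      using K g by blast
    fix C assume C: "C \<noteq> {}" "subset.chain ?A C"
    then have A: "\<And>L. L \<in> C \<Longrightarrow> subgroup L G \<and> K \<subseteq> L \<and> g \<notin> L"
      and chain: "\<And>L M. L \<in> C \<Longrightarrow> M \<in> C \<Longrightarrow> L \<subseteq> M \<or> M \<subseteq> L"
      by (auto simp: subset_chain_def)
    have "subgroup (\<Union>C) G"
      using C(1) A chain by (intro subgroup_Union_chain) simp_all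
    moreover have "K \<subseteq> \<Union>C"
      using C(1) A by (meson Sup_upper2 ex_in_conv)
    moreover have "g \<notin> \<Union>C"
      using A by blast
    ultimately show "\<Union>C \<in> ?A"
      by simp
  qed
  then obtain L where "L \<in> ?A" and maximal: "\<forall>X \<in> ?A. L \<subseteq> X \<longrightarrow> X = L" ..
  then have L: "subgroup L G" "K \<subseteq> L" "g \<notin> L"
    by simp_all
  note sub = subgroup.mem_carrier[OF L(1)]
  have p0: "p > 0"
    using p by (simp add: prime_gt_0_nat)
  have cover: "\<exists>i<p. h \<in> L #> g [^] i" if h: "h \<in> carrier G" for h
  proof (cases "h \<in> L")
    case True
    then have "h \<in> L #> g [^] (0 :: nat)"
      using L(1) by (simp add: coset_mult_one subgroup.subset)
    then show ?thesis
      using p0 by blast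
  next
    case False
    let ?X = "\<Union>j :: nat. L #> h [^] j"
    have "L #> h [^] (0 :: nat) = L"
      using L(1) by (simp add: coset_mult_one subgroup.subset)
    then have "L \<subseteq> ?X"
      by (metis UN_upper UNIV_I)
    moreover have "h \<in> L #> h [^] (1 :: nat)"
      using rcos_self[OF h L(1)] h by simp
    then have "h \<in> ?X"
      by blast
    moreover have "subgroup ?X G"
      by (rule subgroup_adjoin[OF L(1) h exponent[OF h] p0])
    ultimately have "g \<in> ?X"
      using bspec[OF maximal, of ?X] L(2) False by auto
    then obtain l and j :: nat where l: "l \<in> L" "g = l \<otimes> h [^] j"
      by (auto simp: r_coset_def)
    have "\<not> p dvd j"
    proof
      assume "p dvd j"
      then obtain i where "j = p * i"
        by blast
      then have "h [^] j = \<one>"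
        using nat_pow_pow[OF h, of p i] exponent[OF h] by simp
      then show False
        using l L(3) sub by simp
    qed
    then have "coprime j p"
      using prime_imp_coprime[OF p, of j] by (simp add: coprime_commute)
    \<comment> \<open>Solve \<open>g = l \<otimes> h [^] j\<close> for \<open>h\<close> by raising it to the inverse \<open>k\<close> of the exponent \<open>j\<close>.\<close>
    then obtain k where k: "[j * k = 1] (mod p)"
      using cong_solve_coprime_nat by auto
    have "h [^] (j * k) = h"
      using nat_pow_mod_exponent[OF h exponent[OF h], of "j * k"] k
        nat_pow_mod_exponent[OF h exponent[OF h], of 1] h
      by (simp add: cong_def)
    then have "g [^] k = l [^] k \<otimes> h"
      using l h sub by (simp add: nat_pow_distrib nat_pow_pow)
    moreover have lk: "l [^] k \<in> L"
      using L(1) l(1) by (induction k) (simp_all add: subgroup.one_closed subgroup.m_closed)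
    ultimately have "h = inv (l [^] k) \<otimes> g [^] k"
      using h g(1) sub[OF lk] by (simp add: inv_solve_left)
    then have "h = inv (l [^] k) \<otimes> g [^] (k mod p)"
      by (simp only: nat_pow_mod_exponent[OF g(1) exponent[OF g(1)]])
    then have "h \<in> L #> g [^] (k mod p)"
      using subgroup.m_inv_closed[OF L(1) lk] by (auto simp: r_coset_def)
    then show ?thesis
      using p0 by (meson mod_less_divisor)
  qed
  have "rcosets L \<subseteq> (\<lambda>i. L #> g [^] i) ` {..<p}"
  proof
    fix X assume "X \<in> rcosets L"
    then obtain h where h: "h \<in> carrier G" "X = L #> h"
      by (auto simp: RCOSETS_def)
    then obtain i where i: "i < p" "h \<in> L #> g [^] i"
      using cover by blast
    then have "X = L #> g [^] i"
      using h(2) repr_independence[OF i(2) _ L(1)] g(1) by simp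
    then show "X \<in> (\<lambda>i. L #> g [^] i) ` {..<p}"
      using i(1) by blast
  qed
  then have "finite (rcosets L)"
    by (meson finite_imageI finite_lessThan finite_subset)
  then show ?thesis
    using that L by blast
qed

lemma (in group) topspace_profinite_topology: "topspace (profinite_topology G) = carrier G"
proof
  show "topspace (profinite_topology G) \<subseteq> carrier G"
    using openin_profinite_topology openin_topspace by blast
  have "rcosets (carrier G) \<subseteq> {carrier G}"
    by (auto simp: RCOSETS_def coset_join2 subgroup_self)
  then have "finite (rcosets (carrier G))"
    by (rule finite_subset) simp
  then have "openin (profinite_topology G) (carrier G)"
    using subgroup_self unfolding openin_profinite_topology by (auto simp: l_coset_def)
  then show "carrier G \<subseteq> topspace (profinite_topology G)"
    by (rule openin_subset)
qed

text \<open>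
  The coset \<open>g <# L\<close> of a finite-index subgroup \<open>L\<close> that contains \<open>K\<close> but not \<open>g\<close> is disjoint from
  \<open>K\<close>, so the complement of \<open>K\<close> is open.
\<close>

lemma (in comm_group) ERF_prime_exponent:
  assumes p: "prime p" and exponent: "\<And>x. x \<in> carrier G \<Longrightarrow> x [^] (p :: nat) = \<one>"
  shows "ERF G"
  unfolding ERF_def
proof (intro conjI allI impI)
  fix K assume K: "subgroup K G"
  have "\<exists>L. subgroup L G \<and> finite (rcosets L) \<and> g <# L \<subseteq> carrier G - K"
    if g: "g \<in> carrier G - K" for g
  proof -
    obtain L where L: "subgroup L G" "K \<subseteq> L" "g \<notin> L" "finite (rcosets L)"
      using finite_index_subgroup_avoiding[OF p exponent K, of g] g by blast
    have "g \<otimes> l \<notin> K" if l: "l \<in> L" for l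
    proof
      assume "g \<otimes> l \<in> K"
      then have "(g \<otimes> l) \<otimes> inv l \<in> L"
        using L l by (meson subgroup.m_closed subgroup.m_inv_closed subsetD)
      then show False
        using L g l subgroup.mem_carrier[OF L(1)] by (simp add: m_assoc)
    qed
    then show ?thesis
      using L g subgroup.mem_carrier[OF L(1)] by (intro exI[of _ L]) (auto simp: l_coset_def)
  qed
  then show "closedin (profinite_topology G) K"
    using K by (auto simp: closedin_def topspace_profinite_topology openin_profinite_topology
        subgroup.subset)
qed (rule is_group)


section \<open>Rigid stabilizers\<close>

lemma mult_Aut_tree:
  "f \<in> tree_auts m \<Longrightarrow> g \<in> tree_auts m \<Longrightarrow> f \<otimes>\<^bsub>Aut_tree m\<^esub> g = compose (tree_verts m) f g"
  by (simp add: Aut_tree_def BijGroup_def tree_auts_def)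

lemma one_Aut_tree: "\<one>\<^bsub>Aut_tree m\<^esub> = (\<lambda>w \<in> tree_verts m. w)"
  by (simp add: Aut_tree_def BijGroup_def)

lemma carrier_Aut_tree [simp]: "carrier (Aut_tree m) = tree_auts m"
  by (simp add: Aut_tree_def)

text \<open>
  A vertex of the subtree that left it would arrive at a fixed point, against injectivity.
\<close>

lemma rist_preserves_subtree:
  assumes G: "G \<subseteq> tree_auts m" and g: "g \<in> rist m G v" and w: "w \<in> subtree_verts m v"
  shows "g w \<in> subtree_verts m v"
proof (rule ccontr)
  assume out: "g w \<notin> subtree_verts m v"
  have auts: "g \<in> tree_auts m"
    using G g by (auto simp: rist_def)
  have wV: "w \<in> tree_verts m"
    using w by (simp add: subtree_verts_def)
  have gV: "g w \<in> tree_verts m"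
    using auts wV by (rule tree_auts_preserve)
  have "g (g w) = g w"
    using g gV out by (simp add: rist_def)
  moreover have "inj_on g (tree_verts m)"
    using auts by (simp add: tree_auts_def Bij_def bij_betw_def)
  ultimately have "g w = w"
    using gV wV by (meson inj_onD)
  then show False
    using out w by simp
qed

lemma rist_nat_pow_closed:
  assumes G: "subgroup G (Aut_tree m)" and g: "g \<in> rist m G v"
  shows "g [^]\<^bsub>Aut_tree m\<^esub> (n :: nat) \<in> rist m G v"
proof -
  interpret A: group "Aut_tree m"
    by (rule group_Aut_tree)
  have auts: "x \<in> tree_auts m" if "x \<in> G" for x
    using subgroup.mem_carrier[OF G that] by simp
  have one: "\<one>\<^bsub>Aut_tree m\<^esub> \<in> rist m G v"
    using subgroup.one_closed[OF G] unfolding rist_def by (simp add: one_Aut_tree)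
  have mult: "x \<otimes>\<^bsub>Aut_tree m\<^esub> y \<in> rist m G v" if "x \<in> rist m G v" "y \<in> rist m G v" for x y
  proof -
    have "x \<in> G" "y \<in> G"
      using that by (simp_all add: rist_def)
    then show ?thesis
      using that subgroup.m_closed[OF G, of x y] auts
      unfolding rist_def by (simp add: mult_Aut_tree compose_def)
  qed
  show ?thesis
    by (induction n) (simp_all add: one mult g)
qed

lemma rist_element_of_prime_order:
  assumes G: "subgroup G (Aut_tree m)" and p: "prime p" and g: "g \<in> rist m G v"
    and ord: "group.ord (Aut_tree m) g \<noteq> 0" "p dvd group.ord (Aut_tree m) g"
  obtains a where "a \<in> rist m G v" "group.ord (Aut_tree m) a = p"
proof -
  interpret A: group "Aut_tree m"
    by (rule group_Aut_tree)
  obtain k where k: "A.ord g = p * k"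
    using ord(2) by blast
  have "g \<in> carrier (Aut_tree m)"
    using g subgroup.mem_carrier[OF G] by (simp add: rist_def)
  then have "A.ord (g [^]\<^bsub>Aut_tree m\<^esub> k) = p"
    using k ord(1) by (subst A.ord_pow) auto
  then show ?thesis
    using that rist_nat_pow_closed[OF G g] by blast
qed


section \<open>Commuting automorphisms along a spine\<close>

definition spine :: "nat \<Rightarrow> nat list" where
  "spine n = replicate n 0 @ [1]"

text \<open>
  The number of leading zeros recovers \<open>n\<close> at every vertex below \<open>spine n\<close>; this is the only
  information needed to tell the subtrees of the spine vertices apart.
\<close>

definition leading_zeros :: "nat list \<Rightarrow> nat" where
  "leading_zeros w = length (takeWhile (\<lambda>c. c = 0) w)"

lemma leading_zeros_spine: "prefix (spine n) w \<Longrightarrow> leading_zeros w = n"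
  by (auto simp: prefix_def spine_def leading_zeros_def takeWhile_append)

lemma spine_in_tree_verts:
  assumes "\<And>n. n \<ge> 1 \<Longrightarrow> m n \<ge> 2"
  shows "spine n \<in> tree_verts m"
proof -
  have "m (Suc i) > 1" for i
    using assms[of "Suc i"] by simp
  moreover from this have "m (Suc i) > 0" for i
    by (meson less_trans zero_less_one)
  ultimately show ?thesis
    by (auto simp: tree_verts_def spine_def nth_append less_Suc_eq)
qed

locale spine_elements =
  fixes m :: "nat \<Rightarrow> nat" and G :: "(nat list \<Rightarrow> nat list) set" and p :: nat
    and a :: "nat \<Rightarrow> nat list \<Rightarrow> nat list"
  assumes branching: "\<And>n. n \<ge> 1 \<Longrightarrow> m n \<ge> 2"
    and subgroup_G: "subgroup G (Aut_tree m)"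
    and prime_p: "prime p"
    and a_rist: "\<And>n. a n \<in> rist m G (spine n)"
    and a_ord: "\<And>n. group.ord (Aut_tree m) (a n) = p"
begin

sublocale A: group "Aut_tree m"
  by (rule group_Aut_tree)

abbreviation pow_a :: "nat \<Rightarrow> nat \<Rightarrow> nat list \<Rightarrow> nat list" where
  "pow_a n k \<equiv> a n [^]\<^bsub>Aut_tree m\<^esub> k"

lemma G_auts: "g \<in> G \<Longrightarrow> g \<in> tree_auts m"
  using subgroup.mem_carrier[OF subgroup_G] by simp

lemma pow_a_rist: "pow_a n k \<in> rist m G (spine n)"
  using rist_nat_pow_closed[OF subgroup_G a_rist] .

lemma pow_a_in_G: "pow_a n k \<in> G"
  using pow_a_rist[of n k] by (simp add: rist_def)

lemma a_in_G: "a n \<in> G"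
  using a_rist[of n] by (simp add: rist_def)

lemma pow_a_fixes: "w \<in> tree_verts m \<Longrightarrow> leading_zeros w \<noteq> n \<Longrightarrow> pow_a n k w = w"
  using pow_a_rist[of n k] leading_zeros_spine by (auto simp: rist_def subtree_verts_def)

lemma leading_zeros_pow_a:
  assumes w: "w \<in> tree_verts m"
  shows "leading_zeros (pow_a n k w) = leading_zeros w"
proof (cases "w \<in> subtree_verts m (spine n)")
  case True
  then have "pow_a n k w \<in> subtree_verts m (spine n)"
    using rist_preserves_subtree pow_a_rist G_auts by blast
  then show ?thesis
    using True by (simp add: subtree_verts_def leading_zeros_spine[of n])
next
  case False
  then show ?thesis
    using pow_a_rist[of n k] w by (simp add: rist_def)
qed

lemma pow_a_eq_iff: "pow_a n j = pow_a n k \<longleftrightarrow> [j = k] (mod p)"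
proof -
  have "a n \<in> carrier (Aut_tree m)"
    using a_in_G G_auts by simp
  then have "pow_a n j = pow_a n k \<longleftrightarrow> int p dvd int k - int j"
    using A.int_pow_eq[of "a n" "int j" "int k"] by (simp add: int_pow_int a_ord)
  also have "\<dots> \<longleftrightarrow> [j = k] (mod p)"
    by (metis cong_iff_dvd_diff cong_int_iff cong_sym_eq)
  finally show ?thesis .
qed

text \<open>
  The possibly infinite product of the commuting elements \<open>a n [^] x n\<close>, written down as a map:
  a vertex with \<open>n\<close> leading zeros can only be moved by the factor with index \<open>n\<close>. The closed
  formula replaces finite products in a noncommutative group, at the price that membership in \<open>G\<close>
  has to be required separately. Natural exponents suffice because each \<open>a n\<close> has order \<open>p\<close>.
\<close>

definition spine_product :: "(nat \<Rightarrow> nat) \<Rightarrow> nat list \<Rightarrow> nat list" where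
  "spine_product x = (\<lambda>w \<in> tree_verts m. pow_a (leading_zeros w) (x (leading_zeros w)) w)"

lemma pow_a_add:
  assumes "w \<in> tree_verts m"
  shows "pow_a n (j + k) w = pow_a n j (pow_a n k w)"
proof -
  have "a n \<in> carrier (Aut_tree m)"
    using a_in_G G_auts by simp
  then have "pow_a n (j + k) = pow_a n j \<otimes>\<^bsub>Aut_tree m\<^esub> pow_a n k"
    by (simp add: A.nat_pow_mult)
  then show ?thesis
    using assms by (simp add: mult_Aut_tree G_auts pow_a_in_G compose_def)
qed

lemma spine_product_mult:
  assumes "spine_product x \<in> G" "spine_product y \<in> G"
  shows "spine_product x \<otimes>\<^bsub>Aut_tree m\<^esub> spine_product y = spine_product (\<lambda>n. x n + y n)"
proof -
  have "pow_a n k w \<in> tree_verts m" if "w \<in> tree_verts m" for n k w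
    using that tree_auts_preserve G_auts pow_a_in_G by blast
  then have "compose (tree_verts m) (spine_product x) (spine_product y)
      = spine_product (\<lambda>n. x n + y n)"
    by (auto simp: spine_product_def compose_def fun_eq_iff leading_zeros_pow_a pow_a_add)
  then show ?thesis
    using assms by (simp add: mult_Aut_tree G_auts)
qed

lemma spine_product_single: "spine_product (\<lambda>i. if i = n then k else 0) = pow_a n k"
proof
  fix w
  have "pow_a n k \<in> extensional (tree_verts m)"
    using G_auts[OF pow_a_in_G] by (simp add: tree_auts_def Bij_def)
  then show "spine_product (\<lambda>i. if i = n then k else 0) w = pow_a n k w"
    using pow_a_fixes[of w n k]
    by (auto simp: spine_product_def one_Aut_tree extensional_def)
qed

lemma a_eq_spine_product: "a n = spine_product (\<lambda>i. if i = n then 1 else 0)"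
  using A.nat_pow_eone[of "a n"] G_auts[OF a_in_G] by (simp only: spine_product_single carrier_Aut_tree)

text \<open>
  Independence of the \<open>a n\<close>: on the vertices with \<open>n\<close> leading zeros the product agrees with the
  power of \<open>a n\<close>, and elsewhere that power is trivial, so the product determines all its factors.
\<close>

lemma spine_product_eq_iff: "spine_product x = spine_product y \<longleftrightarrow> (\<forall>n. [x n = y n] (mod p))"
proof
  assume eq: "spine_product x = spine_product y"
  show "\<forall>n. [x n = y n] (mod p)"
  proof
    fix n
    have "pow_a n (x n) = pow_a n (y n)"
    proof
      fix w
      show "pow_a n (x n) w = pow_a n (y n) w"
      proof (cases "w \<in> tree_verts m")
        case True
        then show ?thesis
          using fun_cong[OF eq, of w] pow_a_fixes[OF True]
          by (cases "leading_zeros w = n") (auto simp: spine_product_def)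
      next
        case False
        have "pow_a n k \<in> extensional (tree_verts m)" for k
          using G_auts[OF pow_a_in_G] by (simp add: tree_auts_def Bij_def)
        then show ?thesis
          using False by (simp add: extensional_def)
      qed
    qed
    then show "[x n = y n] (mod p)"
      by (simp add: pow_a_eq_iff)
  qed
next
  assume "\<forall>n. [x n = y n] (mod p)"
  then have "pow_a n (x n) = pow_a n (y n)" for n
    by (simp add: pow_a_eq_iff)
  then show "spine_product x = spine_product y"
    by (simp add: spine_product_def)
qed

text \<open>
  The vectors supported on \<open>T\<close> in the kernel of the coordinate sum. That functional is not
  continuous: it is \<open>1\<close> on each \<open>a n\<close> although these converge to the identity. This is why its kernel
  is not closed.
\<close>

definition sum_zero_subgroup :: "nat set \<Rightarrow> (nat list \<Rightarrow> nat list) set" where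
  "sum_zero_subgroup T = {g \<in> G. \<exists>x. g = spine_product x \<and> finite {n. x n \<noteq> 0} \<and>
     {n. x n \<noteq> 0} \<subseteq> T \<and> p dvd Sum_any x}"

lemma sum_zero_subgroup_subset: "sum_zero_subgroup T \<subseteq> G"
  by (auto simp: sum_zero_subgroup_def)

lemma sum_zero_subgroup_mult:
  assumes "g \<in> sum_zero_subgroup T" "h \<in> sum_zero_subgroup T"
  shows "g \<otimes>\<^bsub>Aut_tree m\<^esub> h \<in> sum_zero_subgroup T"
    and "g \<otimes>\<^bsub>Aut_tree m\<^esub> h = h \<otimes>\<^bsub>Aut_tree m\<^esub> g"
proof -
  obtain x y where x: "g = spine_product x" "finite {n. x n \<noteq> 0}" "{n. x n \<noteq> 0} \<subseteq> T"
      "p dvd Sum_any x"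
    and y: "h = spine_product y" "finite {n. y n \<noteq> 0}" "{n. y n \<noteq> 0} \<subseteq> T" "p dvd Sum_any y"
    using assms by (auto simp: sum_zero_subgroup_def)
  have G: "g \<in> G" "h \<in> G"
    using assms sum_zero_subgroup_subset by blast+
  have gh: "g \<otimes>\<^bsub>Aut_tree m\<^esub> h = spine_product (\<lambda>n. x n + y n)"
    using x y G spine_product_mult by simp
  have hg: "h \<otimes>\<^bsub>Aut_tree m\<^esub> g = spine_product (\<lambda>n. y n + x n)"
    using x y G spine_product_mult by simp
  show "g \<otimes>\<^bsub>Aut_tree m\<^esub> h = h \<otimes>\<^bsub>Aut_tree m\<^esub> g"
    using gh hg by (simp add: add.commute)
  have "finite {n. x n + y n \<noteq> 0}"
    by (rule finite_subset[OF _ finite_UnI[OF x(2) y(2)]]) auto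
  moreover have "p dvd Sum_any (\<lambda>n. x n + y n)"
    using x y by (simp add: Sum_any.distrib)
  moreover have "g \<otimes>\<^bsub>Aut_tree m\<^esub> h \<in> G"
    using subgroup.m_closed[OF subgroup_G G] .
  ultimately show "g \<otimes>\<^bsub>Aut_tree m\<^esub> h \<in> sum_zero_subgroup T"
    using gh x(3) y(3) unfolding sum_zero_subgroup_def by blast
qed

lemma spine_product_zero: "spine_product (\<lambda>_. 0) = \<one>\<^bsub>Aut_tree m\<^esub>"
  using spine_product_single[of 0 0] by simp

lemma one_in_sum_zero_subgroup: "\<one>\<^bsub>Aut_tree m\<^esub> \<in> sum_zero_subgroup T"
  using subgroup.one_closed[OF subgroup_G] spine_product_zero
  unfolding sum_zero_subgroup_def by (auto intro!: exI[of _ "\<lambda>_. 0"])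

lemma sum_zero_subgroup_pow:
  assumes "g \<in> sum_zero_subgroup T"
  shows "g [^]\<^bsub>Aut_tree m\<^esub> (k :: nat) \<in> sum_zero_subgroup T"
  by (induction k) (simp_all add: one_in_sum_zero_subgroup sum_zero_subgroup_mult assms)

lemma sum_zero_subgroup_exponent:
  assumes g: "g \<in> sum_zero_subgroup T"
  shows "g [^]\<^bsub>Aut_tree m\<^esub> p = \<one>\<^bsub>Aut_tree m\<^esub>"
proof -
  obtain x where x: "g = spine_product x"
    using g by (auto simp: sum_zero_subgroup_def)
  have "g [^]\<^bsub>Aut_tree m\<^esub> k = spine_product (\<lambda>n. k * x n)" for k
  proof (induction k)
    case 0
    then show ?case
      by (simp add: spine_product_zero)
  next
    case (Suc k)
    have "g [^]\<^bsub>Aut_tree m\<^esub> k \<in> G" "g \<in> G"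
      using sum_zero_subgroup_pow[OF g] g sum_zero_subgroup_subset by blast+
    then show ?case
      using Suc x by (simp add: spine_product_mult add.commute)
  qed
  then have "g [^]\<^bsub>Aut_tree m\<^esub> p = spine_product (\<lambda>_. 0)"
    by (simp add: spine_product_eq_iff cong_0_iff)
  then show ?thesis
    by (simp add: spine_product_zero)
qed

lemma subgroup_sum_zero_subgroup: "subgroup (sum_zero_subgroup T) (Aut_tree m)"
proof (rule A.subgroupI)
  show "sum_zero_subgroup T \<subseteq> carrier (Aut_tree m)"
    using sum_zero_subgroup_subset G_auts by auto
  show "sum_zero_subgroup T \<noteq> {}"
    using one_in_sum_zero_subgroup by blast
  show "inv\<^bsub>Aut_tree m\<^esub> g \<in> sum_zero_subgroup T" if g: "g \<in> sum_zero_subgroup T" for g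
  proof -
    have gc: "g \<in> carrier (Aut_tree m)"
      using g sum_zero_subgroup_subset G_auts by auto
    have "g [^]\<^bsub>Aut_tree m\<^esub> (p - 1) \<otimes>\<^bsub>Aut_tree m\<^esub> g = g [^]\<^bsub>Aut_tree m\<^esub> p"
      using prime_gt_0_nat[OF prime_p] by (metis A.nat_pow_Suc Suc_pred' One_nat_def)
    then have "inv\<^bsub>Aut_tree m\<^esub> g = g [^]\<^bsub>Aut_tree m\<^esub> (p - 1)"
      using A.inv_equality[OF _ gc A.nat_pow_closed[OF gc], of "p - 1"]
        sum_zero_subgroup_exponent[OF g]
      by simp
    then show ?thesis
      using sum_zero_subgroup_pow[OF g] by simp
  qed
qed (rule sum_zero_subgroup_mult)

lemma ERF_sum_zero_subgroup: "ERF (Aut_tree m \<lparr>carrier := sum_zero_subgroup T\<rparr>)"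
proof -
  interpret H: group "Aut_tree m \<lparr>carrier := sum_zero_subgroup T\<rparr>"
    by (rule A.subgroup_imp_group[OF subgroup_sum_zero_subgroup])
  interpret H: comm_group "Aut_tree m \<lparr>carrier := sum_zero_subgroup T\<rparr>"
    by (rule H.group_comm_groupI) (simp add: sum_zero_subgroup_mult)
  show ?thesis
    using prime_p sum_zero_subgroup_exponent
    by (intro H.ERF_prime_exponent[of p]) (simp_all flip: A.nat_pow_consistent)
qed

text \<open>
  The exponent \<open>p - 1\<close> stands for \<open>-1\<close>, making the coordinate sum equal to \<open>p\<close>.
\<close>

lemma a0_pow_a_in_iff:
  assumes "0 \<in> T" and n: "n > 0"
  shows "a 0 \<otimes>\<^bsub>Aut_tree m\<^esub> pow_a n (p - 1) \<in> sum_zero_subgroup T \<longleftrightarrow> n \<in> T"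
proof -
  have p: "p > 1"
    using prime_gt_1_nat[OF prime_p] .
  define z where "z = (\<lambda>i. (if i = 0 then 1 else 0) + (if i = n then p - 1 else 0))"
  have prod: "a 0 \<otimes>\<^bsub>Aut_tree m\<^esub> pow_a n (p - 1) = spine_product z"
    using a_in_G[of 0] pow_a_in_G[of n "p - 1"]
    unfolding a_eq_spine_product[of 0] spine_product_single[of n "p - 1", symmetric] z_def by (rule spine_product_mult)
  have inG: "a 0 \<otimes>\<^bsub>Aut_tree m\<^esub> pow_a n (p - 1) \<in> G"
    using a_in_G pow_a_in_G by (rule subgroup.m_closed[OF subgroup_G])
  have supp: "{i. z i \<noteq> 0} = {0, n}"
    using n p by (auto simp: z_def)
  have "Sum_any z = p"
    unfolding Sum_any.expand_set supp using n p by (simp add: z_def)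
  show ?thesis
  proof
    assume "n \<in> T"
    then show "a 0 \<otimes>\<^bsub>Aut_tree m\<^esub> pow_a n (p - 1) \<in> sum_zero_subgroup T"
      using prod inG supp \<open>Sum_any z = p\<close> \<open>0 \<in> T\<close> unfolding sum_zero_subgroup_def
      by (intro CollectI conjI exI[of _ z]) auto
  next
    assume "a 0 \<otimes>\<^bsub>Aut_tree m\<^esub> pow_a n (p - 1) \<in> sum_zero_subgroup T"
    then obtain x where x: "spine_product z = spine_product x" "{i. x i \<noteq> 0} \<subseteq> T"
      using prod by (auto simp: sum_zero_subgroup_def)
    have "[p - 1 = x n] (mod p)"
      using x(1) n by (auto simp: spine_product_eq_iff z_def dest!: spec[of _ n])
    then have "x n \<noteq> 0"
      using p by (cases "x n = 0") (simp_all add: cong_def)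
    then show "n \<in> T"
      using x(2) by blast
  qed
qed

text \<open>
  Any other exponents representing \<open>a 0\<close> agree with \<open>1, 0, 0, \<dots>\<close> modulo \<open>p\<close>, so their sum is
  \<open>1\<close> modulo \<open>p\<close>.
\<close>

lemma a0_notin_sum_zero_subgroup: "a 0 \<notin> sum_zero_subgroup T"
proof
  assume "a 0 \<in> sum_zero_subgroup T"
  then obtain x where x: "a 0 = spine_product x" "finite {n. x n \<noteq> 0}" "p dvd Sum_any x"
    by (auto simp: sum_zero_subgroup_def)
  let ?e = "\<lambda>i :: nat. if i = 0 then 1 else 0 :: nat"
  have "spine_product ?e = spine_product x"
    using a_eq_spine_product[of 0] x(1) by simp
  then have cong: "[x i = ?e i] (mod p)" for i
    by (metis cong_sym spine_product_eq_iff)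
  let ?F = "insert 0 {n. x n \<noteq> 0}"
  have "[sum x ?F = sum ?e ?F] (mod p)"
    by (rule cong_sum) (rule cong)
  moreover have "sum x ?F = Sum_any x"
    using x(2) by (intro Sum_any.expand_superset[symmetric]) auto
  moreover have "sum ?e ?F = 1"
    using x(2) by simp
  ultimately have "[1 = 0] (mod p)"
    using x(3) by (metis cong_0_iff cong_sym cong_trans)
  then show False
    using prime_p by (simp add: cong_0_iff)
qed

lemma pow_a_level_stab: "pow_a n k \<in> level_stab m G n"
proof -
  have "w \<notin> subtree_verts m (spine n)" if "length w = n" for w
    using that by (auto simp: subtree_verts_def spine_def dest: prefix_length_le)
  then show ?thesis
    using pow_a_rist[of n k] by (auto simp: rist_def level_stab_def)
qed

text \<open>
  Every congruence neighbourhood of \<open>a 0\<close> contains \<open>a 0 \<otimes> inv (a k)\<close> for all large \<open>k\<close>, and for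
  \<open>k\<close> in \<open>T\<close> this lies in the subgroup.
\<close>

lemma not_closedin_sum_zero_subgroup:
  assumes "0 \<in> T" "infinite T"
  shows "\<not> closedin (congruence_topology m G) (sum_zero_subgroup T)"
proof
  have G: "G \<subseteq> tree_auts m"
    using G_auts by blast
  have opn: "openin (congruence_topology m G) U \<longleftrightarrow>
      U \<subseteq> G \<and> (\<forall>g \<in> U. \<exists>n \<ge> 1. g <#\<^bsub>Aut_tree m\<^esub> level_stab m G n \<subseteq> U)" for U
    using G branching by (rule openin_congruence_topology)
  assume closed: "closedin (congruence_topology m G) (sum_zero_subgroup T)"
  have G_open: "openin (congruence_topology m G) G"
    unfolding opn using subgroup.m_closed[OF subgroup_G]
    by (auto simp: l_coset_def level_stab_def)
  have "topspace (congruence_topology m G) = G"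
  proof
    show "topspace (congruence_topology m G) \<subseteq> G"
      using openin_topspace[of "congruence_topology m G"] unfolding opn by (rule conjunct1)
  qed (rule openin_subset[OF G_open])
  then have "openin (congruence_topology m G) (G - sum_zero_subgroup T)"
    using closed by (simp add: closedin_def)
  then obtain n where n: "n \<ge> 1"
      "a 0 <#\<^bsub>Aut_tree m\<^esub> level_stab m G n \<subseteq> G - sum_zero_subgroup T"
    using a_in_G[of 0] a0_notin_sum_zero_subgroup[of T] unfolding opn by blast
  obtain k where k: "k \<in> T" "n < k"
    using assms(2) by (meson infinite_nat_iff_unbounded)
  then have "pow_a k (p - 1) \<in> level_stab m G n"
    using pow_a_level_stab[of k "p - 1"] level_stab_mono[of G m n k] G branching k(2) by auto
  then have "a 0 \<otimes>\<^bsub>Aut_tree m\<^esub> pow_a k (p - 1) \<notin> sum_zero_subgroup T"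
    using n(2) by (auto simp: l_coset_def)
  then show False
    using a0_pow_a_in_iff[of T k] assms(1) k by simp
qed

end


section \<open>Continuum many subgroups\<close>

theorem theorem2:
  fixes m :: "nat \<Rightarrow> nat"
    and G :: "(nat list \<Rightarrow> nat list) set"
    and p :: nat
  assumes "\<And>n. n \<ge> 1 \<Longrightarrow> m n \<ge> 2"
    and "subgroup G (Aut_tree m)"
    and "prime p"
    and "\<And>v. v \<in> tree_verts m \<Longrightarrow>
           \<exists>g \<in> rist m G v. group.ord (Aut_tree m) g \<noteq> 0 \<and> p dvd group.ord (Aut_tree m) g"
  shows "\<exists>\<F>. \<F> \<approx> (UNIV :: nat set set) \<and>
           (\<forall>H \<in> \<F>. subgroup H (Aut_tree m \<lparr>carrier := G\<rparr>) \<and>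
                     ERF (Aut_tree m \<lparr>carrier := H\<rparr>) \<and>
                     \<not> closedin (congruence_topology m G) H)"
proof -
  have "\<exists>b \<in> rist m G (spine n). group.ord (Aut_tree m) b = p" for n
    using assms(4)[OF spine_in_tree_verts[OF assms(1)]]
      rist_element_of_prime_order[OF assms(2,3)] by metis
  then obtain a where a: "\<And>n. a n \<in> rist m G (spine n)" "\<And>n. group.ord (Aut_tree m) (a n) = p"
    by metis
  interpret spine_elements m G p a
    using assms(1-3) a by (rule spine_elements.intro)
  \<comment> \<open>The even indices keep every index set infinite and containing \<open>0\<close>; the odd ones encode \<open>S\<close>.\<close>
  define T where "T S = {n. even n} \<union> {2 * k + 1 | k. k \<in> S}" for S :: "nat set"
  have mem_T: "2 * k + 1 \<in> T S \<longleftrightarrow> k \<in> S" for k S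
    by (auto simp: T_def)
  have zero_T: "0 \<in> T S" for S
    by (simp add: T_def)
  have "infinite (T S)" for S
    unfolding infinite_nat_iff_unbounded
  proof
    fix n
    have "2 * Suc n \<in> T S"
      by (simp add: T_def)
    then show "\<exists>k>n. k \<in> T S"
      by (intro exI[of _ "2 * Suc n"]) simp
  qed
  then have good: "subgroup (sum_zero_subgroup (T S)) (Aut_tree m \<lparr>carrier := G\<rparr>) \<and>
      ERF (Aut_tree m \<lparr>carrier := sum_zero_subgroup (T S)\<rparr>) \<and>
      \<not> closedin (congruence_topology m G) (sum_zero_subgroup (T S))" for S
    using A.subgroup_incl[OF subgroup_sum_zero_subgroup subgroup_G sum_zero_subgroup_subset]
      ERF_sum_zero_subgroup not_closedin_sum_zero_subgroup zero_T by blast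
  have "inj (\<lambda>S. sum_zero_subgroup (T S))"
  proof (rule injI)
    fix R S :: "nat set" assume eq: "sum_zero_subgroup (T R) = sum_zero_subgroup (T S)"
    have "k \<in> U \<longleftrightarrow> a 0 \<otimes>\<^bsub>Aut_tree m\<^esub> pow_a (2 * k + 1) (p - 1) \<in> sum_zero_subgroup (T U)" for k U
      using a0_pow_a_in_iff[OF zero_T, of "2 * k + 1"] mem_T by simp
    then show "R = S"
      using eq by blast
  qed
  then have "range (\<lambda>S. sum_zero_subgroup (T S)) \<approx> (UNIV :: nat set set)"
    by (simp add: inj_on_image_eqpoll_self)
  then show ?thesis
    using good by (intro exI[of _ "range (\<lambda>S. sum_zero_subgroup (T S))"]) blast
qed

end
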